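(* Let $X$ be a topological space, let $Y$ be a compact space, let $D\subseteq X$ and let $f:D\to Y$ be a function. Then $\overline{f}:\overline{D}\multimap Y$ is an upper continuous compact-valued multifunction, where $\overline{D}$ is the closure of $D$ in $X$ and $\overline{f}$ is the cluster multifunction of $f$.
   Context: For $f:D\to Y$ with $D\subseteq X$, the cluster set of $f$ at $x\in X$ is $\overline{f}(x)=\bigcap_{U\in\mathcal{U}_x}\overline{f(U\cap D)}$, where $\mathcal{U}_x$ is the collection of all neighborhoods of $x$ in $X$ and closures of the images are taken in $Y$. The multifunction $x\mapsto\overline{f}(x)$ is the cluster multifunction of $f$. For a set $E$, the notation $F:E\multimap Y$ means that $F$ is a multifunction into $Y$ whose domain $\{x:F(x)\neq\emptyset\}$ is exactly $E$. It is compact-valued if every $F(x)$ is a compact subset of $Y$. For a topological space $E$, the multifunction $F:E\multimap Y$ is upper continuous if for every $x\in E$ and every open set $V\subseteq Y$ with $F(x)\subseteq V$ there is a neighborhood $U$ of $x$ in $E$ such that $F(u)\subseteq V$ for all $u\in U$. *)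

theory Defs
  imports "HOL-Analysis.Analysis"
begin

(* Neighbourhoods need not be open. *)
definition nbhds_in :: "'a topology \<Rightarrow> 'a \<Rightarrow> 'a set set" where
  "nbhds_in X x = {U. U \<subseteq> topspace X \<and> (\<exists>W. openin X W \<and> x \<in> W \<and> W \<subseteq> U)}"

(* A function f : D -> Y is represented by a total HOL function of which only the
   values on D are used.  The definition is meaningful only for x in topspace X: any
   other x has no neighbourhoods, so the intersection degenerates to UNIV. *)
definition cluster_set ::
    "'a topology \<Rightarrow> 'b topology \<Rightarrow> 'a set \<Rightarrow> ('a \<Rightarrow> 'b) \<Rightarrow> 'a \<Rightarrow> 'b set" where
  "cluster_set X Y D f x = (\<Inter>U\<in>nbhds_in X x. Y closure_of (f ` (U \<inter> D)))"

(* F is a multifunction from the points of A into Y whose domain, i.e. the set of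
   points with nonempty value, is exactly E.  A is the set over which the argument
   of F ranges; values of F outside A are irrelevant. *)
definition multifunction_with_domain ::
    "'a set \<Rightarrow> 'a set \<Rightarrow> 'b topology \<Rightarrow> ('a \<Rightarrow> 'b set) \<Rightarrow> bool" where
  "multifunction_with_domain A E Y F \<longleftrightarrow>
     (\<forall>x\<in>A. F x \<subseteq> topspace Y) \<and> {x \<in> A. F x \<noteq> {}} = E"

definition compact_valued :: "'a set \<Rightarrow> 'b topology \<Rightarrow> ('a \<Rightarrow> 'b set) \<Rightarrow> bool" where
  "compact_valued A Y F \<longleftrightarrow> (\<forall>x\<in>A. compactin Y (F x))"

definition upper_continuous ::
    "'a topology \<Rightarrow> 'b topology \<Rightarrow> ('a \<Rightarrow> 'b set) \<Rightarrow> bool" where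
  "upper_continuous E Y F \<longleftrightarrow>
     (\<forall>x\<in>topspace E. \<forall>V. openin Y V \<and> F x \<subseteq> V \<longrightarrow>
        (\<exists>U\<in>nbhds_in E x. \<forall>u\<in>U. F u \<subseteq> V))"

end

theory Submission
  imports Defs
begin

lemma cluster_set_eq_open:
  "cluster_set X Y D f x = (\<Inter>W\<in>{W. openin X W \<and> x \<in> W}. Y closure_of (f ` (W \<inter> D)))"
    (is "_ = ?R")
proof
  show "cluster_set X Y D f x \<subseteq> ?R"
    unfolding cluster_set_def nbhds_in_def
    by (intro INF_superset_mono) (auto dest: openin_subset)
  show "?R \<subseteq> cluster_set X Y D f x"
  proof
    fix y assume y: "y \<in> ?R"
    show "y \<in> cluster_set X Y D f x"
      unfolding cluster_set_def
    proof
      fix U assume "U \<in> nbhds_in X x"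
      then obtain W where W: "openin X W" "x \<in> W" "W \<subseteq> U"
        unfolding nbhds_in_def by blast
      then have "Y closure_of (f ` (W \<inter> D)) \<subseteq> Y closure_of (f ` (U \<inter> D))"
        by (intro closure_of_mono) blast
      with y W show "y \<in> Y closure_of (f ` (U \<inter> D))" by blast
    qed
  qed
qed

text \<open>The point must lie in \<open>topspace X\<close> so that the intersected family has a
  member, namely the one given by \<open>topspace X\<close>.\<close>

lemma closedin_cluster_set:
  assumes "x \<in> topspace X"
  shows "closedin Y (cluster_set X Y D f x)"
  unfolding cluster_set_eq_open using assms by (intro closedin_Inter) auto

text \<open>The closures of the images of the neighbourhoods form a down-directed family of closed
  sets, so by compactness one of them already lies in \<open>V\<close>.\<close>

lemma cluster_set_subset_openin:
  assumes "compact_space Y" "x \<in> topspace X" "openin Y V" "cluster_set X Y D f x \<subseteq> V"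
  obtains W where "openin X W" "x \<in> W" "Y closure_of (f ` (W \<inter> D)) \<subseteq> V"
proof -
  define N where "N = {W. openin X W \<and> x \<in> W}"
  \<comment> \<open>The part of each closure that escapes \<open>V\<close>; it is closed because
    \<open>V\<close> is open.\<close>
  define C where "C W = Y closure_of (f ` (W \<inter> D)) - V" for W
  have "\<exists>W\<in>N. C W = {}"
  proof (rule ccontr)
    assume nonempty: "\<not> (\<exists>W\<in>N. C W = {})"
    have "\<forall>S\<in>C ` N. closedin Y S"
      using assms(3) by (auto simp: C_def intro: closedin_diff)
    moreover have "\<Inter>F \<noteq> {}" if F: "finite F" "F \<subseteq> C ` N" for F
    proof -
      obtain G where G: "finite G" "G \<subseteq> N" "F = C ` G"
        using finite_subset_image[OF F] by blast
      \<comment> \<open>Inserting \<open>topspace X\<close> keeps the intersection open when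
        \<open>G\<close> is empty.\<close>
      define W0 where "W0 = \<Inter>(insert (topspace X) G)"
      have "openin X W0"
        unfolding W0_def using G by (intro openin_Inter) (auto simp: N_def)
      moreover have "x \<in> W0"
        using G(2) assms(2) by (auto simp: W0_def N_def)
      ultimately obtain y where y: "y \<in> C W0"
        using nonempty unfolding N_def by blast
      have "C W0 \<subseteq> C W" if "W \<in> G" for W
        unfolding C_def using that by (intro Diff_mono closure_of_mono) (auto simp: W0_def)
      with y G(3) have "y \<in> \<Inter>F" by blast
      then show ?thesis by blast
    qed
    ultimately have "\<Inter>(C ` N) \<noteq> {}"
      using assms(1)[unfolded compact_space_fip, rule_format, of "C ` N"] by simp
    then obtain y where y: "y \<in> C W" if "W \<in> N" for W by auto
    \<comment> \<open>A member of \<open>N\<close> is needed to read off \<open>y \<notin> V\<close>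
      from \<open>y \<in> C W\<close>.\<close>
    have "topspace X \<in> N"
      using assms(2) by (simp add: N_def)
    moreover have "y \<in> cluster_set X Y D f x"
      using y unfolding cluster_set_eq_open N_def C_def by blast
    ultimately show False
      using y assms(4) unfolding C_def by blast
  qed
  then show thesis
    using that unfolding N_def C_def by blast
qed

text \<open>A neighbourhood missing \<open>D\<close> has empty image, whose closure is empty. The
  converse uses compactness with \<open>V = {}\<close>.\<close>

lemma cluster_set_nonempty_iff:
  assumes "compact_space Y" "f \<in> D \<rightarrow> topspace Y" "x \<in> topspace X"
  shows "cluster_set X Y D f x \<noteq> {} \<longleftrightarrow> x \<in> X closure_of D"
proof
  assume "cluster_set X Y D f x \<noteq> {}"
  then obtain y where y: "y \<in> Y closure_of (f ` (W \<inter> D))" if "openin X W" "x \<in> W" for W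
    unfolding cluster_set_eq_open by auto
  have "W \<inter> D \<noteq> {}" if "openin X W" "x \<in> W" for W
    using y[OF that] by force
  then show "x \<in> X closure_of D"
    using assms(3) unfolding in_closure_of by blast
next
  assume x: "x \<in> X closure_of D"
  show "cluster_set X Y D f x \<noteq> {}"
  proof
    assume "cluster_set X Y D f x = {}"
    then have "cluster_set X Y D f x \<subseteq> {}" by simp
    then obtain W where W: "openin X W" "x \<in> W" "Y closure_of (f ` (W \<inter> D)) \<subseteq> {}"
      by (rule cluster_set_subset_openin[OF assms(1,3) openin_empty])
    have "f ` (W \<inter> D) \<subseteq> Y closure_of (f ` (W \<inter> D))"
      using assms(2) by (intro closure_of_subset) blast
    with W(3) have "W \<inter> D = {}" by simp
    with W(1,2) x show False
      unfolding in_closure_of by blast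
  qed
qed

lemma upper_continuous_cluster_set:
  assumes "compact_space Y"
  shows "upper_continuous X Y (cluster_set X Y D f)"
  unfolding upper_continuous_def
proof (intro ballI allI impI)
  fix x V assume x: "x \<in> topspace X" and V: "openin Y V \<and> cluster_set X Y D f x \<subseteq> V"
  then obtain W where W: "openin X W" "x \<in> W" "Y closure_of (f ` (W \<inter> D)) \<subseteq> V"
    using cluster_set_subset_openin[OF assms] by metis
  have "W \<in> nbhds_in X x"
    using W openin_subset unfolding nbhds_in_def by blast
  moreover have "cluster_set X Y D f u \<subseteq> V" if "u \<in> W" for u
    using W that unfolding cluster_set_eq_open by blast
  ultimately show "\<exists>U\<in>nbhds_in X x. \<forall>u\<in>U. cluster_set X Y D f u \<subseteq> V" by blast
qed

lemma nbhds_in_subtopology: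
  assumes "U \<in> nbhds_in X x" "x \<in> S"
  shows "U \<inter> S \<in> nbhds_in (subtopology X S) x"
proof -
  obtain W where "openin X W" "x \<in> W" "W \<subseteq> U" and U: "U \<subseteq> topspace X"
    using assms(1) unfolding nbhds_in_def by blast
  then have "openin (subtopology X S) (W \<inter> S)" "x \<in> W \<inter> S" "W \<inter> S \<subseteq> U \<inter> S"
    using assms(2) by (auto intro: openin_subtopology_Int)
  with U show ?thesis
    unfolding nbhds_in_def by auto
qed

text \<open>Passes from upper continuity on all of \<open>X\<close> to the closure of
  \<open>D\<close>: neighbourhoods are traced on \<open>S\<close>.\<close>

lemma upper_continuous_subtopology:
  assumes "upper_continuous X Y F"
  shows "upper_continuous (subtopology X S) Y F"
  unfolding upper_continuous_def
proof (intro ballI allI impI)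
  fix x V assume x: "x \<in> topspace (subtopology X S)" and V: "openin Y V \<and> F x \<subseteq> V"
  then obtain U where "U \<in> nbhds_in X x" "\<forall>u\<in>U. F u \<subseteq> V"
    using assms[unfolded upper_continuous_def, rule_format, of x V] by auto
  with x show "\<exists>U\<in>nbhds_in (subtopology X S) x. \<forall>u\<in>U. F u \<subseteq> V"
    by (intro bexI[OF _ nbhds_in_subtopology]) auto
qed

theorem proposition3p2:
  fixes X :: "'a topology" and Y :: "'b topology" and D :: "'a set" and f :: "'a \<Rightarrow> 'b"
  assumes "compact_space Y"
    and "D \<subseteq> topspace X"
    and "f \<in> D \<rightarrow> topspace Y"
  shows "multifunction_with_domain (topspace X) (X closure_of D) Y (cluster_set X Y D f)
    \<and> upper_continuous (subtopology X (X closure_of D)) Y (cluster_set X Y D f)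
    \<and> compact_valued (topspace X) Y (cluster_set X Y D f)"
proof (intro conjI)
  show "multifunction_with_domain (topspace X) (X closure_of D) Y (cluster_set X Y D f)"
    unfolding multifunction_with_domain_def
  proof (intro conjI ballI)
    show "cluster_set X Y D f x \<subseteq> topspace Y" if "x \<in> topspace X" for x
      using that by (intro closedin_subset closedin_cluster_set)
    show "{x \<in> topspace X. cluster_set X Y D f x \<noteq> {}} = X closure_of D"
      using cluster_set_nonempty_iff[OF assms(1,3)] closure_of_subset_topspace[of X D] by auto
  qed
  show "upper_continuous (subtopology X (X closure_of D)) Y (cluster_set X Y D f)"
    by (intro upper_continuous_subtopology upper_continuous_cluster_set assms(1))
  show "compact_valued (topspace X) Y (cluster_set X Y D f)"
    unfolding compact_valued_def
    by (intro ballI closedin_compact_space assms(1) closedin_cluster_set)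
qed

end
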